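(* Let $\tau\in[0,1)$. For every integer $N\ge 1$ and every $p\in\mathbb{C}$, the canonical pre-kernel $\kappa_N$ (defined in the context) satisfies, for all $z,w\in\mathbb{C}$, \begin{align*} \partial_z \kappa_N(z,w)&= \Big( \sqrt{ \tfrac{2(1-\tau) N}{1+\tau} } \, p+2(1-\tau)z\Big) \kappa_N(z,w)\\ &\quad + 2\sqrt{1-\tau^2} \, \sum_{k=0}^{2N-1} \frac{ (\tau/2)^{k} }{k!} H_{k}\Big( \sqrt{ \tfrac{N}{2\tau} } p+\sqrt{\tfrac{1-\tau^2}{\tau}}z \Big) H_{k} \Big( \sqrt{ \tfrac{N}{2\tau} } p+\sqrt{\tfrac{1-\tau^2}{\tau}}w \Big) \\ &\quad - 2\sqrt{1-\tau^2} \frac{ (\tau/2)^{N} }{(2N-1)!!} H_{2N} \Big( \sqrt{ \tfrac{N}{2\tau} } p+\sqrt{\tfrac{1-\tau^2}{\tau}}z \Big) \sum_{l=0}^{N-1} \frac{(\tau/2)^l}{(2l)!!} H_{2l} \Big( \sqrt{ \tfrac{N}{2\tau} } p+\sqrt{\tfrac{1-\tau^2}{\tau}}w \Big) . \end{align*}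
   Context: $H_k$ is the (physicists') Hermite polynomial, $H_k(z)=(-1)^k e^{z^2}\frac{d^k}{dz^k}e^{-z^2}$. Double factorials use $0!!=(-1)!!=1$. The canonical pre-kernel is $$\kappa_N(z,w)=\sqrt{2}(1+\tau)\big(F(z,w)-F(w,z)\big),$$ $$F(z,w)= \sum_{k=0}^{N-1} \frac{ (\tau/2)^{k+\frac12} }{(2k+1)!!} H_{2k+1} \Big( \sqrt{ \tfrac{N}{2\tau} } p+\sqrt{\tfrac{1-\tau^2}{\tau}}z \Big) \sum_{l=0}^k \frac{(\tau/2)^l}{(2l)!!} H_{2l} \Big( \sqrt{ \tfrac{N}{2\tau} } p+\sqrt{\tfrac{1-\tau^2}{\tau}}w \Big).$$ For $\tau=0$ all expressions are understood through the limit $\tau\to0$, i.e. $(\tau/2)^{k/2}H_k\big(\sqrt{\tfrac{N}{2\tau}}p+\sqrt{\tfrac{1-\tau^2}{\tau}}z\big)$ is replaced by $(\sqrt N p+\sqrt2 z)^k$. *)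

theory Defs
  imports "HOL-Analysis.Analysis"
begin

definition hermite :: "nat \<Rightarrow> complex \<Rightarrow> complex" where
  "hermite k z = (- 1) ^ k * exp (z\<^sup>2) * (deriv ^^ k) (\<lambda>u. exp (- (u\<^sup>2))) z"

(* On naturals (- 1)!! = 1 is not representable; truncated 2 * 0 - 1 = 0 gives the same value. *)
fun double_fact :: "nat \<Rightarrow> nat" where
  "double_fact 0 = 1"
| "double_fact (Suc 0) = 1"
| "double_fact (Suc (Suc n)) = Suc (Suc n) * double_fact n"

definition hermite_arg :: "real \<Rightarrow> nat \<Rightarrow> complex \<Rightarrow> complex \<Rightarrow> complex" where
  "hermite_arg \<tau> N p z =
     of_real (sqrt (real N / (2 * \<tau>))) * p + of_real (sqrt ((1 - \<tau>\<^sup>2) / \<tau>)) * z"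

(* The factor (tau/2)^(k/2) H_k(...), with its limit as tau tends to 0 as the value at tau = 0.
   Each power of tau/2 in the kernel and in its derivative is distributed over the Hermite
   factors it multiplies; the lemmas below recover the formulas with separate powers. *)
definition scaled_hermite :: "real \<Rightarrow> nat \<Rightarrow> complex \<Rightarrow> nat \<Rightarrow> complex \<Rightarrow> complex" where
  "scaled_hermite \<tau> N p k z =
     (if \<tau> = 0 then (of_real (sqrt (real N)) * p + of_real (sqrt 2) * z) ^ k
      else of_real ((\<tau> / 2) powr (real k / 2)) * hermite k (hermite_arg \<tau> N p z))"

definition F_kernel :: "real \<Rightarrow> nat \<Rightarrow> complex \<Rightarrow> complex \<Rightarrow> complex \<Rightarrow> complex" where
  "F_kernel \<tau> N p z w =
     (\<Sum>k<N. scaled_hermite \<tau> N p (2 * k + 1) z / of_nat (double_fact (2 * k + 1)) *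
        (\<Sum>l\<le>k. scaled_hermite \<tau> N p (2 * l) w / of_nat (double_fact (2 * l))))"

definition pre_kernel :: "real \<Rightarrow> nat \<Rightarrow> complex \<Rightarrow> complex \<Rightarrow> complex \<Rightarrow> complex" where
  "pre_kernel \<tau> N p z w =
     of_real (sqrt 2 * (1 + \<tau>)) * (F_kernel \<tau> N p z w - F_kernel \<tau> N p w z)"

lemma scaled_hermite_even:
  assumes "\<tau> > 0"
  shows "scaled_hermite \<tau> N p (2 * l) z = of_real ((\<tau> / 2) ^ l) * hermite (2 * l) (hermite_arg \<tau> N p z)"
  using assms by (simp add: scaled_hermite_def powr_realpow)

lemma scaled_hermite_odd:
  assumes "\<tau> > 0"
  shows "scaled_hermite \<tau> N p (2 * k + 1) z =
    of_real ((\<tau> / 2) powr (real k + 1 / 2)) * hermite (2 * k + 1) (hermite_arg \<tau> N p z)"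
proof -
  have "real (2 * k + 1) / 2 = real k + 1 / 2" by simp
  then show ?thesis using assms by (simp only: scaled_hermite_def) simp
qed

lemma scaled_hermite_mult:
  assumes "\<tau> > 0"
  shows "scaled_hermite \<tau> N p k z * scaled_hermite \<tau> N p k w =
    of_real ((\<tau> / 2) ^ k) * hermite k (hermite_arg \<tau> N p z) * hermite k (hermite_arg \<tau> N p w)"
proof -
  have "(\<tau> / 2) powr (real k / 2) * (\<tau> / 2) powr (real k / 2) = (\<tau> / 2) ^ k"
    using assms by (simp flip: powr_add add: powr_realpow)
  then have "complex_of_real ((\<tau> / 2) powr (real k / 2)) * of_real ((\<tau> / 2) powr (real k / 2))
      = of_real ((\<tau> / 2) ^ k)"
    by (metis of_real_mult)
  then have *: "(complex_of_real ((\<tau> / 2) powr (real k / 2)) * a) * (of_real ((\<tau> / 2) powr (real k / 2)) * b)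
      = of_real ((\<tau> / 2) ^ k) * a * b" for a b
    by (metis mult.assoc mult.left_commute)
  have "\<tau> \<noteq> 0" using assms by simp
  then show ?thesis
    unfolding scaled_hermite_def by (simp only: if_False *)
qed

lemma F_kernel_pos:
  assumes "\<tau> > 0"
  shows "F_kernel \<tau> N p z w =
    (\<Sum>k<N. of_real ((\<tau> / 2) powr (real k + 1 / 2)) / of_nat (double_fact (2 * k + 1)) *
        hermite (2 * k + 1) (hermite_arg \<tau> N p z) *
        (\<Sum>l\<le>k. of_real ((\<tau> / 2) ^ l) / of_nat (double_fact (2 * l)) *
           hermite (2 * l) (hermite_arg \<tau> N p w)))"
  unfolding F_kernel_def scaled_hermite_even[OF assms] scaled_hermite_odd[OF assms]
  by (simp only: times_divide_eq_left)

end

theory Submission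
  imports Defs
begin

text \<open>
  With $c = \sqrt{2(1-\tau^2)}$ and $y = \sqrt N p + c z$, the scaled polynomials $h_k$ satisfy
  $h_{k+1} = y h_k - k \tau h_{k-1}$ and $\partial_z h_k = c k h_{k-1}$. Using only these two
  relations, $(1+\tau) c^{-1} \partial_z$ of the skew sum minus $y$ times the skew sum is evaluated
  by induction on the number of summands: the recurrence at odd index makes the terms containing the
  inner sums in $w$ telescope, the recurrence at even index does so for the inner sums in $z$, and
  $k! = k!!\,(k-1)!!$ turns what is left into the Christoffel--Darboux type sum.
\<close>

section \<open>Recurrence and derivative of the Hermite polynomials\<close>

lemma has_field_derivative_higher_deriv_gauss:
  fixes z :: complex
  defines "g \<equiv> \<lambda>k. (deriv ^^ k) (\<lambda>u::complex. exp (- (u\<^sup>2)))"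
  shows "(g k has_field_derivative g (Suc k) z) (at z)"
    and "g (Suc k) z = - 2 * z * g k z - 2 * of_nat k * g (k - 1) z"
proof -
  \<comment> \<open>Both claims go through one induction: the recurrence writes \<open>g k\<close>,
    with k = j + 1, through \<open>g j\<close> and \<open>g (j - 1)\<close>, whose derivatives the
    induction hypothesis supplies, so differentiability passes up to \<open>g k\<close>.\<close>
  have "(\<forall>z. (g k has_field_derivative g (Suc k) z) (at z)) \<and>
    (\<forall>z. g (Suc k) z = - 2 * z * g k z - 2 * of_nat k * g (k - 1) z)"
  proof (induction k rule: less_induct)
    case (less k)
    have D: "(g k has_field_derivative - 2 * z * g k z - 2 * of_nat k * g (k - 1) z) (at z)" for z
    proof (cases k)
      case 0
      have "((\<lambda>u. exp (- (u\<^sup>2))) has_field_derivative - 2 * z * exp (- (z\<^sup>2))) (at z)"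
        by (auto intro!: derivative_eq_intros)
      with 0 show ?thesis by (simp add: g_def)
    next
      case (Suc j)
      have eq: "g k = (\<lambda>z. - 2 * z * g j z - 2 * of_nat j * g (j - 1) z)"
        using less[of j] Suc by auto
      have 1: "(g j has_field_derivative g k z) (at z)"
        using less[of j] Suc by auto
      \<comment> \<open>For j = 0 the truncated index j - 1 is harmless, since its coefficient is
        0.\<close>
      have 2: "((\<lambda>z. of_nat j * g (j - 1) z) has_field_derivative of_nat j * g j z) (at z)"
      proof (cases j)
        case (Suc i)
        then have "(g i has_field_derivative g j z) (at z)"
          using less[of i] \<open>k = Suc j\<close> by auto
        with Suc show ?thesis by (auto intro!: DERIV_cmult simp del: of_nat_Suc)
      qed simp
      have "((\<lambda>z. - 2 * z * g j z - 2 * (of_nat j * g (j - 1) z)) has_field_derivative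
        - 2 * z * g k z - 2 * of_nat k * g j z) (at z)"
        by (rule derivative_eq_intros 1 2 refl)+ (simp add: Suc algebra_simps)
      then have "((\<lambda>z. - 2 * z * g j z - 2 * of_nat j * g (j - 1) z) has_field_derivative
        - 2 * z * g k z - 2 * of_nat k * g (k - 1) z) (at z)"
        by (simp only: mult.assoc Suc diff_Suc_1)
      then show ?thesis by (simp only: eq[symmetric])
    qed
    moreover have "g (Suc k) z = - 2 * z * g k z - 2 * of_nat k * g (k - 1) z" for z
      using DERIV_imp_deriv[OF D] by (simp add: g_def)
    ultimately show ?case by simp
  qed
  then show "(g k has_field_derivative g (Suc k) z) (at z)"
    and "g (Suc k) z = - 2 * z * g k z - 2 * of_nat k * g (k - 1) z" by auto
qed

lemma hermite_Suc: "hermite (Suc k) z = 2 * z * hermite k z - 2 * of_nat k * hermite (k - 1) z"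
proof (cases k)
  case 0
  then show ?thesis
    using has_field_derivative_higher_deriv_gauss(2)[of 0 z]
    by (simp add: hermite_def)
next
  case (Suc j)
  show ?thesis
    unfolding hermite_def has_field_derivative_higher_deriv_gauss(2)[of k z]
    by (simp add: Suc algebra_simps)
qed

lemma has_field_derivative_hermite:
  "(hermite k has_field_derivative 2 * of_nat k * hermite (k - 1) z) (at z)"
proof -
  let ?g = "\<lambda>k. (deriv ^^ k) (\<lambda>u::complex. exp (- (u\<^sup>2)))"
  \<comment> \<open>The product rule differentiates exp(z^2) and the k-th Gaussian derivative
    separately; the recurrence then removes \<open>hermite (Suc k)\<close>.\<close>
  have "(hermite k has_field_derivative 2 * z * hermite k z - hermite (Suc k) z) (at z)"
    unfolding hermite_def[abs_def]
    by (rule derivative_eq_intros has_field_derivative_higher_deriv_gauss(1) refl)+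
       (simp add: algebra_simps)
  then show ?thesis by (simp add: hermite_Suc)
qed

section \<open>The two relations for the scaled polynomials, including \<tau> = 0\<close>

lemma scaled_hermite_sqrt_power:
  assumes "\<tau> > 0"
  shows "scaled_hermite \<tau> N p k z = of_real (sqrt (\<tau> / 2)) ^ k * hermite k (hermite_arg \<tau> N p z)"
proof -
  have "(\<tau> / 2) powr (real k / 2) = ((\<tau> / 2) powr (1 / 2)) powr real k"
    by (simp add: powr_powr)
  also have "\<dots> = sqrt (\<tau> / 2) ^ k"
    using assms by (simp add: powr_half_sqrt powr_realpow)
  finally show ?thesis using assms by (simp add: scaled_hermite_def)
qed

text \<open>The factor sqrt(\<tau>/2) cancels the singular 1/sqrt(\<tau>) of the Hermite argument.
  What remains is the y of the scaled recurrence, which also makes sense at \<tau> = 0.\<close>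

lemma sqrt_scaled_hermite_arg:
  assumes "0 < \<tau>"
  shows "2 * of_real (sqrt (\<tau> / 2)) * hermite_arg \<tau> N p z =
    of_real (sqrt (real N)) * p + of_real (sqrt (2 * (1 - \<tau>\<^sup>2))) * z"
proof -
  have two: "2 = sqrt (4::real)" by simp
  have "2 * sqrt (\<tau> / 2) * sqrt (real N / (2 * \<tau>)) = sqrt (real N)"
    unfolding two real_sqrt_mult[symmetric] using assms by (simp add: field_simps)
  moreover have "2 * sqrt (\<tau> / 2) * sqrt ((1 - \<tau>\<^sup>2) / \<tau>) = sqrt (2 * (1 - \<tau>\<^sup>2))"
    unfolding two real_sqrt_mult[symmetric] using assms by (simp add: field_simps)
  ultimately show ?thesis
    unfolding hermite_arg_def distrib_left mult.assoc[symmetric]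
    by (metis of_real_mult of_real_numeral)
qed

lemma scaled_hermite_Suc:
  assumes "0 \<le> \<tau>"
  shows "scaled_hermite \<tau> N p (Suc k) z =
    (of_real (sqrt (real N)) * p + of_real (sqrt (2 * (1 - \<tau>\<^sup>2))) * z) * scaled_hermite \<tau> N p k z
    - of_nat k * of_real \<tau> * scaled_hermite \<tau> N p (k - 1) z"
proof (cases "\<tau> = 0")
  case True
  then show ?thesis by (simp add: scaled_hermite_def)
next
  case False
  with assms have pos: "\<tau> > 0" by simp
  let ?t = "complex_of_real (sqrt (\<tau> / 2))"
  have t: "2 * ?t * ?t = of_real \<tau>"
    using pos by (simp add: mult.assoc flip: of_real_mult)
  \<comment> \<open>Two of the k + 1 factors \<open>?t\<close>, together with the 2, make up \<tau>.
    For k = 0 both sides vanish.\<close>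
  have lower: "?t ^ Suc k * (2 * of_nat k * h) = of_nat k * of_real \<tau> * (?t ^ (k - 1) * h)" for h
    by (cases k) (simp_all flip: t)
  show ?thesis
    unfolding scaled_hermite_sqrt_power[OF pos] hermite_Suc sqrt_scaled_hermite_arg[OF pos, symmetric]
    unfolding right_diff_distrib lower by (simp add: mult_ac)
qed

lemma has_field_derivative_scaled_hermite:
  assumes "0 \<le> \<tau>"
  shows "(scaled_hermite \<tau> N p k has_field_derivative
    of_real (sqrt (2 * (1 - \<tau>\<^sup>2))) * (of_nat k * scaled_hermite \<tau> N p (k - 1) z)) (at z)"
proof (cases "\<tau> = 0")
  case True
  then show ?thesis
    unfolding scaled_hermite_def[abs_def]
    by (auto intro!: derivative_eq_intros)
next
  case False
  with assms have pos: "\<tau> > 0" by simp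
  let ?t = "complex_of_real (sqrt (\<tau> / 2))"
  let ?b = "complex_of_real (sqrt ((1 - \<tau>\<^sup>2) / \<tau>))"
  \<comment> \<open>Taking N = 0, p = 0, z = 1 isolates the coefficient of z.\<close>
  have b: "2 * ?t * ?b = of_real (sqrt (2 * (1 - \<tau>\<^sup>2)))"
    using sqrt_scaled_hermite_arg[OF pos, of 0 0 1] by (simp add: hermite_arg_def)
  have arg: "(hermite_arg \<tau> N p has_field_derivative ?b) (at z)"
    unfolding hermite_arg_def[abs_def] by (auto intro!: derivative_eq_intros)
  have "((\<lambda>z. ?t ^ k * hermite k (hermite_arg \<tau> N p z)) has_field_derivative
    ?t ^ k * (2 * of_nat k * hermite (k - 1) (hermite_arg \<tau> N p z) * ?b)) (at z)"
    by (intro DERIV_cmult DERIV_chain2[OF has_field_derivative_hermite arg])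
  moreover have "?t ^ k * (2 * of_nat k * h * ?b) =
      of_real (sqrt (2 * (1 - \<tau>\<^sup>2))) * (of_nat k * (?t ^ (k - 1) * h))" for h
    unfolding b[symmetric] by (cases k) (simp_all add: mult_ac)
  ultimately show ?thesis
    by (simp add: scaled_hermite_sqrt_power[OF pos, abs_def])
qed

section \<open>Algebra of the skew sums for abstract sequences\<close>

lemma double_fact_pos: "double_fact n > 0"
  by (induction n rule: double_fact.induct) auto

lemma fact_eq_double_fact: "fact (Suc n) = double_fact (Suc n) * double_fact n"
proof (induction n)
  case (Suc n)
  have "fact (Suc (Suc n)) = Suc (Suc n) * fact (Suc n)" by (simp only: fact_Suc of_nat_id)
  also have "\<dots> = double_fact (Suc (Suc n)) * double_fact (Suc n)"
    unfolding Suc.IH double_fact.simps(3) by (simp only: mult_ac)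
  finally show ?case .
qed simp

text \<open>The inner sum of F for a generic sequence, so that it applies alike to the h_k at z, at
  w and to k h_{k-1}. Here n counts summands: the range l \<le> k corresponds to n = k + 1.\<close>

definition even_sum :: "(nat \<Rightarrow> 'a::field_char_0) \<Rightarrow> nat \<Rightarrow> 'a" where
  "even_sum a n = (\<Sum>l<n. a (2 * l) / of_nat (double_fact (2 * l)))"

lemma even_sum_Suc:
  "even_sum a (Suc n) = even_sum a n + a (2 * n) / of_nat (double_fact (2 * n))"
  by (simp add: even_sum_def)

text \<open>With a and b the values h_k(z) and h_k(w), this is F(z,w) - F(w,z) merged into one
  sum.\<close>

definition skew_sum :: "(nat \<Rightarrow> 'a::field_char_0) \<Rightarrow> (nat \<Rightarrow> 'a) \<Rightarrow> nat \<Rightarrow> 'a" where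
  "skew_sum a b n = (\<Sum>k<n. (a (2 * k + 1) * even_sum b (Suc k) - b (2 * k + 1) * even_sum a (Suc k))
     / of_nat (double_fact (2 * k + 1)))"

text \<open>The summand added in the induction step is (1 + t) a(2n+1)/(2n)!!. Its t part is
  absorbed by the recurrence for a(2n+3), and its other part cancels the old boundary term.\<close>

lemma even_sum_recurrence:
  fixes a :: "nat \<Rightarrow> 'a::field_char_0"
  assumes rec: "\<And>k. a (Suc k) = y * a k - of_nat k * t * a (k - 1)"
  shows "(1 + t) * even_sum (\<lambda>k. of_nat k * a (k - 1)) (Suc n) =
    y * even_sum a (Suc n) - a (2 * n + 1) / of_nat (double_fact (2 * n))"
proof (induction n)
  case 0
  then show ?case using rec[of 0] by (simp add: even_sum_def)
next
  case (Suc n)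
  let ?d = "of_nat (double_fact (2 * n)) :: 'a"
  let ?m = "of_nat (2 * n + 2) :: 'a"
  have nz: "?d \<noteq> 0" "?m \<noteq> 0"
    using double_fact_pos[of "2 * n"] by (simp_all only: of_nat_eq_0_iff)
  have df: "of_nat (double_fact (2 * Suc n)) = ?m * ?d"
    by (simp add: algebra_simps)
  have a3: "a (2 * Suc n + 1) = y * a (2 * Suc n) - ?m * t * a (2 * n + 1)"
    using rec[of "2 * Suc n"] by simp
  have m: "of_nat (2 * Suc n) * a (2 * Suc n - 1) = ?m * a (2 * n + 1)"
    by simp
  show ?case
    unfolding even_sum_Suc[of _ "Suc n"] distrib_left Suc.IH df a3 m
    using nz by (simp add: field_simps del: of_nat_Suc of_nat_add of_nat_mult)
qed

text \<open>In the step from n to n + 1, the recurrence for a(2n+2) turns the t part of the term in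
  a(2n) into a multiple of y and the new boundary term. The rest of that term cancels the old
  boundary term and leaves the diagonal term of index 2n. The inner sum of \<open>da\<close>,
  evaluated by \<open>even_sum_recurrence\<close>, contributes the diagonal term of index 2n +
  1.\<close>

lemma skew_sum_recurrence:
  fixes a b :: "nat \<Rightarrow> 'a::field_char_0"
  assumes rec: "\<And>k. a (Suc k) = y * a k - of_nat k * t * a (k - 1)"
  defines "da \<equiv> \<lambda>k. of_nat k * a (k - 1)"
  shows "(1 + t) * skew_sum da b n = y * skew_sum a b n + (\<Sum>k<2 * n. a k * b k / fact k)
    - a (2 * n) / of_nat (double_fact (2 * n - 1)) * even_sum b n"
proof (induction n)
  case 0
  then show ?case by (simp add: skew_sum_def even_sum_def)
next
  case (Suc n)
  let ?e = "of_nat (double_fact (2 * n - 1)) :: 'a"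
  let ?d = "of_nat (double_fact (2 * n)) :: 'a"
  let ?m = "of_nat (2 * n + 1) :: 'a"
  let ?Eb = "even_sum b n"
  let ?Ea = "even_sum a (Suc n)"
  have nz: "?e \<noteq> 0" "?d \<noteq> 0" "?m \<noteq> 0"
    using double_fact_pos[of "2 * n"] double_fact_pos[of "2 * n - 1"]
    by (simp_all only: of_nat_eq_0_iff)
  \<comment> \<open>At n = 0 the truncated 2n - 1 is 0, and \<open>double_fact 0\<close> stands in
    for (-1)!! = 1.\<close>
  have df: "of_nat (double_fact (2 * n + 1)) = ?m * ?e"
    by (cases n) (simp_all add: algebra_simps)
  have "fact (2 * n) = double_fact (2 * n) * double_fact (2 * n - 1)"
    using fact_eq_double_fact[of "2 * n - 1"] by (cases n) (simp_all del: fact_Suc double_fact.simps(3))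
  from arg_cong[OF this, of "of_nat :: nat \<Rightarrow> 'a"] have fact_even: "fact (2 * n) = ?d * ?e"
    by (simp only: of_nat_fact of_nat_mult)
  have "fact (Suc (2 * n)) = double_fact (2 * n + 1) * double_fact (2 * n)"
    using fact_eq_double_fact[of "2 * n"] by simp
  from arg_cong[OF this, of "of_nat :: nat \<Rightarrow> 'a"] have fact_odd: "fact (Suc (2 * n)) = ?m * ?e * ?d"
    by (simp only: of_nat_fact of_nat_mult df)
  have a2: "a (2 * Suc n) = y * a (2 * n + 1) - ?m * t * a (2 * n)"
    using rec[of "2 * n + 1"] by simp
  have E: "(1 + t) * even_sum da (Suc n) = y * ?Ea - a (2 * n + 1) / ?d"
    unfolding da_def by (rule even_sum_recurrence[OF rec])
  have "(1 + t) * skew_sum da b (Suc n) = (1 + t) * skew_sum da b n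
      + ((1 + t) * ?m * a (2 * n) * even_sum b (Suc n)
        - b (2 * n + 1) * ((1 + t) * even_sum da (Suc n))) / (?m * ?e)"
    unfolding df[symmetric] by (simp add: skew_sum_def da_def algebra_simps diff_divide_distrib add_divide_distrib)
  also have "\<dots> = y * skew_sum a b n + (\<Sum>k<2 * n. a k * b k / fact k)
      - a (2 * n) / ?e * ?Eb
      + ((1 + t) * ?m * a (2 * n) * (?Eb + b (2 * n) / ?d)
        - b (2 * n + 1) * (y * ?Ea - a (2 * n + 1) / ?d)) / (?m * ?e)"
    unfolding Suc.IH E even_sum_Suc[of b] ..
  \<comment> \<open>The new boundary term is kept in the expanded form of \<open>a2\<close>, so that
    this is a plain field identity.\<close>
  also have "\<dots> = y * (skew_sum a b n
        + (a (2 * n + 1) * (?Eb + b (2 * n) / ?d) - b (2 * n + 1) * ?Ea) / (?m * ?e))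
      + ((\<Sum>k<2 * n. a k * b k / fact k) + a (2 * n) * b (2 * n) / (?d * ?e)
        + a (2 * n + 1) * b (2 * n + 1) / (?m * ?e * ?d))
      - (y * a (2 * n + 1) - ?m * t * a (2 * n)) / (?m * ?e) * (?Eb + b (2 * n) / ?d)"
    using nz by (simp add: field_simps del: of_nat_Suc of_nat_add of_nat_mult)
  also have "\<dots> = y * skew_sum a b (Suc n) + (\<Sum>k<2 * Suc n. a k * b k / fact k)
      - a (2 * Suc n) / of_nat (double_fact (2 * Suc n - 1)) * even_sum b (Suc n)"
  proof -
    have "skew_sum a b (Suc n) = skew_sum a b n
        + (a (2 * n + 1) * even_sum b (Suc n) - b (2 * n + 1) * ?Ea) / (?m * ?e)"
      unfolding df[symmetric] by (simp add: skew_sum_def)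
    moreover have "(\<Sum>k<2 * Suc n. a k * b k / fact k) = (\<Sum>k<2 * n. a k * b k / fact k)
        + a (2 * n) * b (2 * n) / (?d * ?e) + a (2 * n + 1) * b (2 * n + 1) / (?m * ?e * ?d)"
      unfolding fact_even[symmetric] fact_odd[symmetric] by (simp del: fact_Suc)
    moreover have "2 * Suc n - 1 = 2 * n + 1" by simp
    ultimately show ?thesis by (simp only: df a2 even_sum_Suc[of b])
  qed
  finally show ?case .
qed

section \<open>Differentiation of the pre-kernel\<close>

lemma has_field_derivative_skew_sum:
  assumes "\<And>k. ((\<lambda>z. a z k) has_field_derivative c * da k) (at z)"
  shows "((\<lambda>z. skew_sum (a z) b n) has_field_derivative c * skew_sum da b n) (at z)"
proof -
  have E: "((\<lambda>z. even_sum (a z) m) has_field_derivative c * even_sum da m) (at z)" for m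
    unfolding even_sum_def sum_distrib_left times_divide_eq_right
    by (intro DERIV_sum DERIV_cdivide assms)
  have eq: "c * skew_sum da b n =
      (\<Sum>k<n. (c * da (2 * k + 1) * even_sum b (Suc k) - b (2 * k + 1) * (c * even_sum da (Suc k)))
        / of_nat (double_fact (2 * k + 1)))"
    unfolding skew_sum_def sum_distrib_left
    by (intro sum.cong refl) (simp add: algebra_simps)
  show ?thesis
    unfolding eq unfolding skew_sum_def
    by (intro DERIV_sum DERIV_cdivide DERIV_diff DERIV_cmult DERIV_cmult_right assms E)
qed

lemma pre_kernel_eq_skew_sum:
  "pre_kernel \<tau> N p z w = of_real (sqrt 2 * (1 + \<tau>)) *
    skew_sum (\<lambda>k. scaled_hermite \<tau> N p k z) (\<lambda>k. scaled_hermite \<tau> N p k w) N"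
  unfolding pre_kernel_def F_kernel_def skew_sum_def even_sum_def lessThan_Suc_atMost
  by (simp add: sum_subtractf diff_divide_distrib)

theorem proposition1p1:
  fixes \<tau> :: real and N :: nat and p z w :: complex
  assumes "0 \<le> \<tau>" and "\<tau> < 1" and "N \<ge> 1"
  shows "((\<lambda>z. pre_kernel \<tau> N p z w) has_field_derivative
      (of_real (sqrt (2 * (1 - \<tau>) * real N / (1 + \<tau>))) * p + of_real (2 * (1 - \<tau>)) * z)
          * pre_kernel \<tau> N p z w
      + of_real (2 * sqrt (1 - \<tau>\<^sup>2)) *
          (\<Sum>k\<le>2 * N - 1. scaled_hermite \<tau> N p k z * scaled_hermite \<tau> N p k w / fact k)
      - of_real (2 * sqrt (1 - \<tau>\<^sup>2)) *
          (scaled_hermite \<tau> N p (2 * N) z / of_nat (double_fact (2 * N - 1))) *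
          (\<Sum>l<N. scaled_hermite \<tau> N p (2 * l) w / of_nat (double_fact (2 * l)))) (at z)"
proof -
  let ?h = "\<lambda>k. scaled_hermite \<tau> N p k z" and ?g = "\<lambda>k. scaled_hermite \<tau> N p k w"
  let ?c = "complex_of_real (sqrt (2 * (1 - \<tau>\<^sup>2)))"
  let ?y = "of_real (sqrt (real N)) * p + ?c * z"
  let ?S = "skew_sum ?h ?g N"
  let ?R = "(\<Sum>k<2 * N. ?h k * ?g k / fact k)
    - ?h (2 * N) / of_nat (double_fact (2 * N - 1)) * even_sum ?g N"
  have "((\<lambda>z. pre_kernel \<tau> N p z w) has_field_derivative
      of_real (sqrt 2 * (1 + \<tau>)) * (?c * skew_sum (\<lambda>k. of_nat k * ?h (k - 1)) ?g N)) (at z)"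
    unfolding pre_kernel_eq_skew_sum
    by (intro DERIV_cmult has_field_derivative_skew_sum has_field_derivative_scaled_hermite assms)
  \<comment> \<open>The 1 + \<tau> in the prefactor of the kernel is the factor that
    \<open>skew_sum_recurrence\<close> asks for.\<close>
  also have "of_real (sqrt 2 * (1 + \<tau>)) * (?c * skew_sum (\<lambda>k. of_nat k * ?h (k - 1)) ?g N)
      = of_real (sqrt 2) * ?c * ((1 + of_real \<tau>) * skew_sum (\<lambda>k. of_nat k * ?h (k - 1)) ?g N)"
    by simp
  also have "\<dots> = of_real (sqrt 2) * ?c * (?y * ?S + ?R)"
    by (subst skew_sum_recurrence[OF scaled_hermite_Suc[OF assms(1)]]) (simp add: algebra_simps)
  also have "of_real (sqrt 2) * ?c = complex_of_real (2 * sqrt (1 - \<tau>\<^sup>2))"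
    by (simp add: real_sqrt_mult del: right_diff_distrib_numeral flip: of_real_mult mult.assoc)
  \<comment> \<open>The pre-kernel is sqrt 2 (1 + \<tau>) times the skew sum, so this factor has to
    be split off 2 sqrt(1 - \<tau>^2) y, separately in the p and z terms.\<close>
  also have "of_real (2 * sqrt (1 - \<tau>\<^sup>2)) * (?y * ?S + ?R) =
      (of_real (sqrt (2 * (1 - \<tau>) * real N / (1 + \<tau>))) * p + of_real (2 * (1 - \<tau>)) * z)
        * pre_kernel \<tau> N p z w + of_real (2 * sqrt (1 - \<tau>\<^sup>2)) * ?R"
  proof -
    have sq: "sqrt (1 - \<tau>\<^sup>2) = sqrt (1 - \<tau>) * sqrt (1 + \<tau>)"
      by (simp add: algebra_simps power2_eq_square flip: real_sqrt_mult)
    \<comment> \<open>Writing sqrt(1 + \<tau>) as (1 + \<tau>)/sqrt(1 + \<tau>) exposes the factor 1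
      + \<tau> and leaves the denominator of the stated coefficient.\<close>
    have "2 * sqrt (1 - \<tau>\<^sup>2) * sqrt (real N) =
        2 * sqrt (1 - \<tau>) * sqrt (real N) * ((1 + \<tau>) / sqrt (1 + \<tau>))"
      using assms by (simp add: sq real_div_sqrt)
    also have "\<dots> = sqrt (2 * (1 - \<tau>) * real N / (1 + \<tau>)) * (sqrt 2 * (1 + \<tau>))"
      by (simp only: real_sqrt_mult real_sqrt_divide) (simp flip: mult.assoc)
    finally have p_coeff: "2 * sqrt (1 - \<tau>\<^sup>2) * sqrt (real N) =
        sqrt (2 * (1 - \<tau>) * real N / (1 + \<tau>)) * (sqrt 2 * (1 + \<tau>))" .
    have z_coeff: "2 * sqrt (1 - \<tau>\<^sup>2) * sqrt (2 * (1 - \<tau>\<^sup>2)) = 2 * (1 - \<tau>) * (sqrt 2 * (1 + \<tau>))"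
    proof -
      have "2 * sqrt (1 - \<tau>\<^sup>2) * sqrt (2 * (1 - \<tau>\<^sup>2)) = 2 * sqrt 2 * (sqrt (1 - \<tau>\<^sup>2))\<^sup>2"
        by (simp only: real_sqrt_mult power2_eq_square mult_ac)
      also have "(sqrt (1 - \<tau>\<^sup>2))\<^sup>2 = (1 - \<tau>) * (1 + \<tau>)"
        using assms by (simp add: power_le_one) (simp add: power2_eq_square algebra_simps)
      finally show ?thesis by (simp only: mult_ac)
    qed
    have "complex_of_real (2 * sqrt (1 - \<tau>\<^sup>2)) * ?y =
        of_real (2 * sqrt (1 - \<tau>\<^sup>2) * sqrt (real N)) * p
        + of_real (2 * sqrt (1 - \<tau>\<^sup>2) * sqrt (2 * (1 - \<tau>\<^sup>2))) * z"
      by (simp only: distrib_left mult.assoc of_real_mult)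
    also have "\<dots> = (of_real (sqrt (2 * (1 - \<tau>) * real N / (1 + \<tau>))) * p + of_real (2 * (1 - \<tau>)) * z)
        * of_real (sqrt 2 * (1 + \<tau>))"
      unfolding p_coeff z_coeff of_real_mult[of _ "sqrt 2 * (1 + \<tau>)"]
      by (simp only: ring_distribs mult_ac)
    finally have "complex_of_real (2 * sqrt (1 - \<tau>\<^sup>2)) * ?y =
      (of_real (sqrt (2 * (1 - \<tau>) * real N / (1 + \<tau>))) * p + of_real (2 * (1 - \<tau>)) * z)
        * of_real (sqrt 2 * (1 + \<tau>))" .
    then show ?thesis
      unfolding pre_kernel_eq_skew_sum distrib_left mult.assoc[symmetric] by simp
  qed
  \<comment> \<open>N \<ge> 1 keeps the subtraction 2N - 1 from truncating.\<close>
  also have "{..<2 * N} = {..2 * N - 1}"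
    using \<open>N \<ge> 1\<close> by auto
  finally show ?thesis
    by (simp only: even_sum_def right_diff_distrib mult.assoc add_diff_eq)
qed

end
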